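(* Let $p_1,\dots,p_5$ be five points in the projective plane over $\mathbb{K}\in\{\mathbb{R},\mathbb{C}\}$, no three collinear, and let $\mathcal{A}$ be the unique conic through them. Construct: $O$ = intersection of the lines $p_1p_4$ and $p_2p_5$; $P$ = intersection of $p_1p_3$ and $p_2p_4$; $Q$ = intersection of $p_2p_4$ and $p_3p_5$; $R$ = intersection of $p_1p_5$ and $OP$; $l$ = the line through $R$ and $Q$. Let $p_6$ be either of the two intersection points of $l$ with $\mathcal{A}$. If none of these construction steps is degenerate, then $p_6$ is an admissible sixth point of a Poncelet heptagon, i.e. $p_1,\dots,p_6$ are six consecutive points of a Poncelet heptagon with circumscribed conic $\mathcal{A}$.
   Context: Poncelet chains: given conics $\mathcal{A}$ (outer) and $\mathcal{B}$ (inner), a Poncelet chain is a sequence $p_1,p_2,\dots$ of points on $\mathcal{A}$ obtained as follows: $l_1$ is a tangent to $\mathcal{B}$ through $p_1$; $p_{i+1}$ is the intersection of $l_i$ with $\mathcal{A}$ other than $p_i$; $l_{i+1}$ is the tangent to $\mathcal{B}$ through $p_{i+1}$ other than $l_i$. If the chain closes after $7$ steps ($p_{i+7}=p_i$ for all $i$), then $p_1,\dots,p_7$ is a Poncelet heptagon. A construction step is degenerate if the two lines (or points) it intersects (or joins) coincide, so that the constructed element is not well defined. *)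

theory Defs
  imports "HOL-Analysis.Analysis"
begin

section \<open>The projective plane over a field\<close>

definition proportional :: "'k::field ^ 3 \<Rightarrow> 'k ^ 3 \<Rightarrow> bool" where
  "proportional u v \<longleftrightarrow> u \<noteq> 0 \<and> v \<noteq> 0 \<and> (\<exists>c. u = c *s v)"

lemma proportionalE:
  assumes "proportional u v"
  obtains c where "c \<noteq> 0" "u = c *s v"
  using assms unfolding proportional_def by (metis vector_smult_lzero)

quotient_type (overloaded) 'k proj_plane = "'k::field ^ 3" / partial: proportional
proof (rule part_equivpI)
  show "\<exists>u::'k ^ 3. proportional u u"
    by (rule exI[of _ "1"]) (auto simp: proportional_def intro: exI[of _ 1])
  show "symp (proportional :: 'k ^ 3 \<Rightarrow> _)"
  proof (rule sympI)
    fix u v :: "'k ^ 3"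
    assume uv: "proportional u v"
    then obtain c where c: "c \<noteq> 0" "u = c *s v" by (rule proportionalE)
    then have "v = inverse c *s u" by (simp add: vector_smult_assoc)
    with uv show "proportional v u" unfolding proportional_def by blast
  qed
  show "transp (proportional :: 'k ^ 3 \<Rightarrow> _)"
    by (rule transpI) (auto simp: proportional_def vector_smult_assoc)
qed

lift_definition proj_collinear ::
  "'k::field proj_plane \<Rightarrow> 'k proj_plane \<Rightarrow> 'k proj_plane \<Rightarrow> bool"
  is "\<lambda>u v w. det (vector [u, v, w] :: 'k ^ 3 ^ 3) = 0"
proof -
  fix u u' v v' w w' :: "'k ^ 3"
  assume "proportional u u'" "proportional v v'" "proportional w w'"
  then obtain a b c where
    abc: "a \<noteq> 0" "b \<noteq> 0" "c \<noteq> 0" "u = a *s u'" "v = b *s v'" "w = c *s w'"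
    by (metis proportionalE)
  have "det (vector [u, v, w] :: 'k ^ 3 ^ 3) = a * b * c * det (vector [u', v', w'] :: 'k ^ 3 ^ 3)"
    unfolding abc(4-6) by (simp add: det_3 algebra_simps)
  with abc(1-3) show "(det (vector [u, v, w] :: 'k ^ 3 ^ 3) = 0) =
      (det (vector [u', v', w'] :: 'k ^ 3 ^ 3) = 0)" by simp
qed

text \<open>The line joining two distinct points (for \<open>p = q\<close> this is the whole plane).\<close>

definition proj_line :: "'k::field proj_plane \<Rightarrow> 'k proj_plane \<Rightarrow> 'k proj_plane set" where
  "proj_line p q = {r. proj_collinear p q r}"


section \<open>Conics and their tangents\<close>

text \<open>A conic is given by its coefficients, i.e. by a nonzero symmetric matrix \<open>M\<close> (unique up to
  a nonzero factor), and not by its point set, which over the reals may be empty or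
  fail to determine \<open>M\<close>.\<close>

definition is_conic :: "'k::field ^ 3 ^ 3 \<Rightarrow> bool" where
  "is_conic M \<longleftrightarrow> M \<noteq> 0 \<and> transpose M = M"

definition nondegenerate_conic :: "'k::field ^ 3 ^ 3 \<Rightarrow> bool" where
  "nondegenerate_conic M \<longleftrightarrow> is_conic M \<and> det M \<noteq> 0"

definition bilin :: "'k::field ^ 3 ^ 3 \<Rightarrow> 'k ^ 3 \<Rightarrow> 'k ^ 3 \<Rightarrow> 'k" where
  "bilin M u v = (\<Sum>i\<in>UNIV. \<Sum>j\<in>UNIV. u $ i * M $ i $ j * v $ j)"

lift_definition conjugate :: "'k::field ^ 3 ^ 3 \<Rightarrow> 'k proj_plane \<Rightarrow> 'k proj_plane \<Rightarrow> bool"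
  is "\<lambda>M u v. bilin M u v = 0"
proof -
  fix M :: "'k ^ 3 ^ 3" and u u' v v' :: "'k ^ 3"
  assume "proportional u u'" "proportional v v'"
  then obtain a b where ab: "a \<noteq> 0" "b \<noteq> 0" "u = a *s u'" "v = b *s v'"
    by (metis proportionalE)
  have "bilin M u v = a * b * bilin M u' v'"
    unfolding bilin_def ab(3-4) by (simp add: sum_distrib_left algebra_simps)
  with ab(1-2) show "(bilin M u v = 0) = (bilin M u' v' = 0)" by simp
qed

definition conic_points :: "'k::field ^ 3 ^ 3 \<Rightarrow> 'k proj_plane set" where
  "conic_points M = {p. conjugate M p p}"

definition polar :: "'k::field ^ 3 ^ 3 \<Rightarrow> 'k proj_plane \<Rightarrow> 'k proj_plane set" where
  "polar M p = {q. conjugate M p q}"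

text \<open>The tangent to a nondegenerate conic at one of its points is the polar of that point.
  Used for nondegenerate conics only.\<close>

definition tangents :: "'k::field ^ 3 ^ 3 \<Rightarrow> 'k proj_plane set set" where
  "tangents M = polar M ` conic_points M"


section \<open>Poncelet chains\<close>

text \<open>Chains are indexed from 1; the values at 0 are irrelevant.\<close>

definition poncelet_chain ::
  "'k::field ^ 3 ^ 3 \<Rightarrow> 'k ^ 3 ^ 3 \<Rightarrow> (nat \<Rightarrow> 'k proj_plane) \<Rightarrow> (nat \<Rightarrow> 'k proj_plane set) \<Rightarrow> bool" where
  "poncelet_chain A B p l \<longleftrightarrow>
     nondegenerate_conic A \<and> nondegenerate_conic B \<and>
     p 1 \<in> conic_points A \<and> l 1 \<in> tangents B \<and> p 1 \<in> l 1 \<and>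
     (\<forall>i\<ge>1. p (i + 1) \<in> l i \<inter> conic_points A \<and> p (i + 1) \<noteq> p i \<and>
            l (i + 1) \<in> tangents B \<and> p (i + 1) \<in> l (i + 1) \<and> l (i + 1) \<noteq> l i)"

definition poncelet_heptagon ::
  "'k::field ^ 3 ^ 3 \<Rightarrow> 'k ^ 3 ^ 3 \<Rightarrow> (nat \<Rightarrow> 'k proj_plane) \<Rightarrow> bool" where
  "poncelet_heptagon A B p \<longleftrightarrow> (\<exists>l. poncelet_chain A B p l) \<and> (\<forall>i\<ge>1. p (i + 7) = p i)"

end

theory Submission
  imports Defs
begin

text \<open>Choose coordinates in which \<open>A\<close> is the conic \<open>x z = y\<^sup>2\<close>, parametrised by \<open>t \<mapsto> (t\<^sup>2, t, 1)\<close>, and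
  \<open>p\<^sub>1, \<dots>, p\<^sub>6\<close> have the parameters \<open>\<infinity>, 0, 1, a, b, x\<close>. The line \<open>l\<close> then turns into a quadratic
  equation for \<open>x\<close>. The five lines \<open>p\<^sub>1p\<^sub>2, \<dots>, p\<^sub>5p\<^sub>6\<close> determine a dual conic, and its second tangents through
  \<open>p\<^sub>1\<close> and \<open>p\<^sub>6\<close> meet \<open>A\<close> again in the same point, namely the one with parameter
  \<open>y = a b (x - 1) / ((a - 1) x)\<close>, precisely because of that equation. All the inequalities that
  keep the dual conic nondegenerate and neighbouring points and lines distinct follow from
  \<open>a, b, 0, 1\<close> being distinct and the equation for \<open>x\<close>, since in each case a coincidence turns the
  quadratic into a nonzero product of factors \<open>a\<close>, \<open>b\<close>, \<open>a - 1\<close>, \<open>b - 1\<close>, \<open>a - b\<close>.\<close>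

section \<open>Homogeneous coordinates\<close>

lemma proportional_refl: "u \<noteq> 0 \<Longrightarrow> proportional u u"
  by (auto simp: proportional_def intro: exI[of _ 1])

lemma proj_plane_cases:
  obtains v where "v \<noteq> 0" "p = abs_proj_plane v"
  by (induct p rule: proj_plane.abs_induct) (auto simp: proportional_def)

lemma proj_collinear_abs:
  assumes "u \<noteq> 0" "v \<noteq> 0" "w \<noteq> 0"
  shows "proj_collinear (abs_proj_plane u) (abs_proj_plane v) (abs_proj_plane w)
    \<longleftrightarrow> det (vector [u, v, w]) = 0"
  using assms by (simp add: proj_collinear.abs_eq proportional_refl)

lemma conjugate_abs:
  assumes "u \<noteq> 0" "v \<noteq> 0"
  shows "conjugate N (abs_proj_plane u) (abs_proj_plane v) \<longleftrightarrow> bilin N u v = 0"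
  using assms by (simp add: conjugate.abs_eq proportional_refl)

lemma abs_proj_plane_scale:
  assumes "u \<noteq> 0" "c \<noteq> 0"
  shows "abs_proj_plane (c *s u) = abs_proj_plane u"
proof -
  have "proportional (c *s u) u"
    using assms by (auto simp: proportional_def)
  then show ?thesis
    by (rule Quotient3_rel_abs[OF Quotient3_proj_plane])
qed

lemma det_vector_matrix_mult:
  "det (vector [M *v u, M *v v, M *v w] :: 'k::field ^ 3 ^ 3) = det M * det (vector [u, v, w] :: 'k ^ 3 ^ 3)"
proof -
  have "(vector [M *v u, M *v v, M *v w] :: 'k ^ 3 ^ 3) = vector [u, v, w] ** transpose M"
    by (simp add: vec_eq_iff forall_3 matrix_vector_mult_def matrix_matrix_mult_def transpose_def
        sum_3 mult.commute)
  then show ?thesis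
    by (simp add: det_mul mult.commute)
qed

lemma matrix_vector_mult_nonzero:
  fixes M :: "'k::field ^ 3 ^ 3"
  assumes "det M \<noteq> 0" "u \<noteq> 0"
  shows "M *v u \<noteq> 0"
proof -
  obtain N where "N ** M = mat 1"
    using assms(1) by (metis invertible_det_nz invertible_def)
  then have "N *v (M *v u) = u"
    by (simp add: matrix_vector_mul_assoc)
  then show ?thesis
    using assms(2) by auto
qed

lemma matrix_vector_mult_surj:
  fixes M :: "'k::field ^ 3 ^ 3"
  assumes "det M \<noteq> 0" "v \<noteq> 0"
  obtains u where "u \<noteq> 0" "M *v u = v"
proof -
  obtain N where "M ** N = mat 1"
    using assms(1) by (metis invertible_det_nz invertible_def)
  then have "M *v (N *v v) = v"
    by (simp add: matrix_vector_mul_assoc)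
  then show ?thesis
    using assms(2) by (intro that[of "N *v v"]) auto
qed

lemma bilin_mult: "bilin N (M *v u) (M *v v) = bilin (transpose M ** N ** M) u v"
  by (simp add: bilin_def matrix_vector_mult_def matrix_matrix_mult_def transpose_def sum_3
      algebra_simps)

lemma bilin_mult_left: "bilin N (M *v u) v = bilin (transpose M ** N) u v"
  by (simp add: bilin_def matrix_vector_mult_def matrix_matrix_mult_def transpose_def sum_3
      algebra_simps)

lemma bilin_mat_1: "bilin (mat 1) u v = (\<Sum>i\<in>UNIV. u $ i * v $ i)" for u v :: "'k::field ^ 3"
  by (simp add: bilin_def mat_def sum_3)

lemma bilin_commute:
  assumes "transpose N = N"
  shows "bilin N u v = bilin N v u"
proof -
  have "N $ i $ j = N $ j $ i" for i j
    using arg_cong[OF assms, of "\<lambda>M. M $ i $ j"] by (simp add: transpose_def)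
  then show ?thesis
    by (simp add: bilin_def sum_3 algebra_simps)
qed
text \<open>Coefficient vector of the line joining \<open>u\<close> and \<open>v\<close>; it
  vanishes when \<open>u\<close> and \<open>v\<close> are proportional.\<close>

definition cross :: "'k::field ^ 3 \<Rightarrow> 'k ^ 3 \<Rightarrow> 'k ^ 3" where
  "cross u v = vector [u$2 * v$3 - u$3 * v$2, u$3 * v$1 - u$1 * v$3, u$1 * v$2 - u$2 * v$1]"

lemma bilin_cross_det: "bilin (mat 1) (cross u v) w = det (vector [u, v, w])"
  by (simp add: bilin_mat_1 cross_def sum_3 det_3 algebra_simps)

text \<open>Line coordinates transform contragrediently to points. Pairing the cross product with a
  third vector gives a determinant, and \<open>M\<close> multiplies that determinant by
  \<open>det M\<close>.\<close>

lemma transpose_mult_cross: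
  fixes M :: "'k::field ^ 3 ^ 3"
  shows "transpose M *v cross (M *v u) (M *v v) = det M *s cross u v"
proof -
  have "bilin (mat 1) (transpose M *v cross (M *v u) (M *v v)) w = bilin (mat 1) (det M *s cross u v) w"
    for w
  proof -
    have "bilin (mat 1) (transpose M *v cross (M *v u) (M *v v)) w
        = bilin (mat 1) (cross (M *v u) (M *v v)) (M *v w)"
      unfolding bilin_mat_1
      by (simp add: matrix_vector_mult_def transpose_def sum_3 algebra_simps)
    also have "\<dots> = det M * bilin (mat 1) (cross u v) w"
      by (simp add: bilin_cross_det det_vector_matrix_mult)
    also have "\<dots> = bilin (mat 1) (det M *s cross u v) w"
      unfolding bilin_mat_1 by (simp add: sum_distrib_left mult.assoc)
    finally show ?thesis .
  qed
  \<comment> \<open>Pairing with the unit vectors recovers the single coordinates.\<close>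
  from this[of "axis _ 1"] show ?thesis
    by (simp add: bilin_mat_1 vec_eq_iff axis_def if_distrib sum.delta cong: if_cong)
qed

section \<open>Heptagons from dual conics\<close>

text \<open>The dual conic \<open>D\<close> is the inverse of \<open>B\<close>: the line with coefficient vector \<open>a\<close> touches \<open>B\<close>, at
  the point \<open>D a\<close>, iff \<open>a\<close> lies on \<open>D\<close>.\<close>

lemma proj_line_in_tangents:
  fixes D :: "'k::field ^ 3 ^ 3"
  assumes sym: "transpose D = D" and inv: "D ** B = mat 1" and D0: "det D \<noteq> 0"
    and nz: "u \<noteq> 0" "v \<noteq> 0" "cross u v \<noteq> 0"
    and tangent: "bilin D (cross u v) (cross u v) = 0"
  shows "proj_line (abs_proj_plane u) (abs_proj_plane v) \<in> tangents B"
proof -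
  define z where "z = D *v cross u v"
  have z0: "z \<noteq> 0"
    unfolding z_def using D0 nz(3) by (rule matrix_vector_mult_nonzero)
  \<comment> \<open>Symmetry of \<open>D\<close> and \<open>D ** B = mat 1\<close> cancel the two
    matrices, so the polar of \<open>z\<close> has the coefficient vector
    \<open>cross u v\<close>.\<close>
  have Bz: "bilin B z w = det (vector [u, v, w])" for w
    by (simp add: z_def bilin_mult_left sym inv bilin_cross_det)
  have "bilin B z z = bilin (mat 1) (cross u v) (D *v cross u v)"
    unfolding Bz by (simp add: bilin_cross_det z_def)
  also have "\<dots> = bilin D (cross u v) (cross u v)"
    unfolding bilin_mat_1 by (simp add: bilin_def matrix_vector_mult_def sum_3 algebra_simps)
  finally have "bilin B z z = 0"
    using tangent by simp
  then have "abs_proj_plane z \<in> conic_points B"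
    using z0 by (simp add: conic_points_def conjugate_abs)
  moreover have "proj_line (abs_proj_plane u) (abs_proj_plane v) = polar B (abs_proj_plane z)"
  proof -
    have "proj_collinear (abs_proj_plane u) (abs_proj_plane v) r = conjugate B (abs_proj_plane z) r"
      for r
    proof -
      obtain w where "w \<noteq> 0" "r = abs_proj_plane w"
        by (rule proj_plane_cases)
      then show ?thesis
        using nz z0 by (simp add: proj_collinear_abs conjugate_abs Bz)
    qed
    then show ?thesis
      by (simp add: proj_line_def polar_def)
  qed
  ultimately show ?thesis
    by (simp add: tangents_def)
qed

text \<open>Passes from a dual conic back to the inscribed conic. The transposed inverse is again an
  inverse, so uniqueness makes it symmetric.\<close>

lemma symmetric_inverse:
  fixes D :: "'k::field ^ 3 ^ 3"
  assumes sym: "transpose D = D" and D0: "det D \<noteq> 0"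
  obtains B where "D ** B = mat 1" "nondegenerate_conic B"
proof -
  obtain B where B: "D ** B = mat 1" "B ** D = mat 1"
    using D0 by (metis invertible_det_nz invertible_def)
  have "transpose B ** D = transpose (D ** B)"
    by (simp add: matrix_transpose_mul sym)
  then have BD: "transpose B ** D = mat 1"
    by (simp add: B(1))
  have "transpose B = transpose B ** (D ** B)"
    by (simp add: B(1))
  also have "\<dots> = B"
    by (simp add: matrix_mul_assoc BD)
  finally have "transpose B = B" .
  moreover have "det D * det B = 1"
    using B(1) by (simp flip: det_mul)
  then have "det B \<noteq> 0"
    by auto
  moreover from this have "B \<noteq> 0"
    by (auto simp: det_3)
  ultimately show ?thesis
    using B(1) that by (simp add: nondegenerate_conic_def is_conic_def)
qed

text \<open>Noncollinearity of consecutive triples is the single source of the inequalities in a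
  chain: it makes the representatives nonzero and keeps neighbouring vertices and neighbouring sides
  distinct.\<close>

lemma poncelet_heptagonI:
  fixes W :: "nat \<Rightarrow> 'k::field ^ 3"
  assumes A: "nondegenerate_conic A"
    and D: "transpose D = D" "det D \<noteq> 0"
    and per: "\<And>n. W (n + 7) = W n"
    and on_A: "\<And>n. bilin A (W n) (W n) = 0"
    and noncol: "\<And>n. det (vector [W n, W (n + 1), W (n + 2)] :: 'k ^ 3 ^ 3) \<noteq> 0"
    and tangent: "\<And>n. bilin D (cross (W n) (W (n + 1))) (cross (W n) (W (n + 1))) = 0"
  shows "\<exists>B. poncelet_heptagon A B (\<lambda>n. abs_proj_plane (W n))"
proof -
  obtain B where B: "D ** B = mat 1" "nondegenerate_conic B"
    using D by (rule symmetric_inverse)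
  let ?q = "\<lambda>n. abs_proj_plane (W n)"
  let ?l = "\<lambda>n. proj_line (?q n) (?q (n + 1))"
  have W0: "W n \<noteq> 0" for n
    using noncol[of n] by (auto simp: det_3)
  have "cross (W n) (W (n + 1)) \<noteq> 0" for n
    using noncol[of n] by (auto simp: bilin_cross_det[symmetric] bilin_def)
  then have tan: "?l n \<in> tangents B" for n
    using D B(1) W0 tangent by (intro proj_line_in_tangents) auto
  have col: "?q n \<in> ?l n" "?q (n + 1) \<in> ?l n" for n
    using W0 by (simp_all add: proj_line_def proj_collinear_abs det_3)
  have ncol: "?q (n + 2) \<notin> ?l n" for n
    using W0 noncol[of n] by (simp add: proj_line_def proj_collinear_abs)
  have "?q (n + 1) \<noteq> ?q n" for n
  proof
    assume "?q (n + 1) = ?q n"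
    \<comment> \<open>For coinciding points \<open>proj_line\<close> is the whole plane and would
      contain \<open>?q (n + 2)\<close>.\<close>
    moreover have "?q (n + 2) \<in> proj_line (?q n) (?q n)"
      using W0 by (simp add: proj_line_def proj_collinear_abs det_3)
    ultimately show False
      using ncol[of n] by simp
  qed
  moreover have "?l (n + 1) \<noteq> ?l n" for n
    using ncol[of n] col(2)[of "n + 1"] by (auto simp: add.assoc)
  moreover have "?q n \<in> conic_points A" for n
    using on_A W0 by (simp add: conic_points_def conjugate_abs)
  ultimately have "poncelet_chain A B ?q ?l"
    unfolding poncelet_chain_def using A B(2) tan col by blast
  then show ?thesis
    unfolding poncelet_heptagon_def using per by (intro exI[of _ B] conjI allI impI exI[of _ ?l]) simp_all
qed

section \<open>The parametrised conic\<close>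

abbreviation pt_inf :: "'k::field ^ 3" where
  "pt_inf \<equiv> vector [1, 0, 0]"

definition pt :: "'k::field \<Rightarrow> 'k ^ 3" where
  "pt t = vector [t\<^sup>2, t, 1]"

lemma pt_nth [simp]: "pt t $ 1 = t\<^sup>2" "pt t $ 2 = t" "pt t $ 3 = 1"
  by (simp_all add: pt_def)

lemma pt_nonzero [simp]: "pt t \<noteq> 0" "pt_inf \<noteq> (0 :: 'k::field ^ 3)"
  by (simp_all add: vec_eq_iff forall_3)

text \<open>The quadratic form is 2 (x z - y^2); the factor 2 avoids halves in the symmetric
  matrix.\<close>

definition std_conic :: "'k::field ^ 3 ^ 3" where
  "std_conic = vector [vector [0, 0, 1], vector [0, - 2, 0], vector [1, 0, 0]]"

lemma bilin_std_conic: "bilin std_conic u v = u$1 * v$3 + u$3 * v$1 - 2 * u$2 * v$2"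
  by (simp add: bilin_def std_conic_def sum_3)

text \<open>Vandermonde determinants: three points of the standard conic are collinear only if two
  parameters coincide.\<close>

lemma det_pt:
  "det (vector [pt r, pt s, pt t]) = (r - s) * (r - t) * (s - t)"
  "det (vector [pt_inf, pt s, pt t]) = s - t"
  "det (vector [pt r, pt_inf, pt t]) = t - r"
  "det (vector [pt r, pt s, pt_inf]) = r - s"
  by (simp_all add: det_3 algebra_simps power2_eq_square)

definition sym_matrix :: "'k::field \<Rightarrow> 'k \<Rightarrow> 'k \<Rightarrow> 'k \<Rightarrow> 'k \<Rightarrow> 'k \<Rightarrow> 'k ^ 3 ^ 3" where
  "sym_matrix d11 d12 d13 d22 d23 d33 =
     vector [vector [d11, d12, d13], vector [d12, d22, d23], vector [d13, d23, d33]]"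

lemma transpose_sym_matrix: "transpose (sym_matrix d11 d12 d13 d22 d23 d33) = sym_matrix d11 d12 d13 d22 d23 d33"
  by (simp add: sym_matrix_def transpose_def vec_eq_iff forall_3)

text \<open>Up to the factor \<open>s - t\<close>, the chord has coordinates 1, -(s + t), s t.
  Tangency thus becomes a quadratic condition on the sum and product of the two parameters.\<close>

lemma bilin_sym_matrix_cross_pt:
  fixes s t d11 d12 d13 d22 d23 d33 :: "'k::field"
  defines "Q \<equiv> \<lambda>u v. bilin (sym_matrix d11 d12 d13 d22 d23 d33) (cross u v) (cross u v)"
  shows "Q (pt s) (pt t) = (s - t)\<^sup>2 * (d11 - 2 * d12 * (s + t) + 2 * d13 * s * t
      + d22 * (s + t)\<^sup>2 - 2 * d23 * (s + t) * s * t + d33 * s\<^sup>2 * t\<^sup>2)"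
    and "Q pt_inf (pt t) = d22 - 2 * d23 * t + d33 * t\<^sup>2"
    and "Q (pt t) pt_inf = d22 - 2 * d23 * t + d33 * t\<^sup>2"
proof -
  have cross_eq: "cross (pt s) (pt t) = (s - t) *s vector [1, - (s + t), s * t]"
    by (simp add: cross_def vec_eq_iff forall_3 algebra_simps power2_eq_square)
  show "Q (pt s) (pt t) = (s - t)\<^sup>2 * (d11 - 2 * d12 * (s + t) + 2 * d13 * s * t
      + d22 * (s + t)\<^sup>2 - 2 * d23 * (s + t) * s * t + d33 * s\<^sup>2 * t\<^sup>2)"
    unfolding Q_def cross_eq
    by (simp add: bilin_def sym_matrix_def sum_3) (simp add: algebra_simps power2_eq_square)
  show "Q pt_inf (pt t) = d22 - 2 * d23 * t + d33 * t\<^sup>2"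
    and "Q (pt t) pt_inf = d22 - 2 * d23 * t + d33 * t\<^sup>2"
    by (simp_all add: Q_def bilin_def sym_matrix_def cross_def sum_3 algebra_simps power2_eq_square)
qed

section \<open>The standard heptagon\<close>

locale heptagon_params =
  fixes a b x y :: "'k::field_char_0"
  assumes a: "a \<noteq> 0" "a \<noteq> 1" and b: "b \<noteq> 0" "b \<noteq> 1" and ab: "a \<noteq> b"
    and sixth: "b * (a - 1) * x\<^sup>2 - a * (a - b + b\<^sup>2 - 1) * x + a * b * (b - 1) = 0"
    and y_def: "y = a * b * (x - 1) / ((a - 1) * x)"
begin

lemma x_neq: "x \<noteq> 0" "x \<noteq> 1" "x \<noteq> a" "x \<noteq> b"
proof -
  show "x \<noteq> 0"
    using sixth a b by auto
  have "b * (a - 1) * 1\<^sup>2 - a * (a - b + b\<^sup>2 - 1) * 1 + a * b * (b - 1) = (a - b) * (1 - a)"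
    by (simp add: algebra_simps power2_eq_square)
  then show "x \<noteq> 1"
    using sixth a ab by auto
  have "b * (a - 1) * a\<^sup>2 - a * (a - b + b\<^sup>2 - 1) * a + a * b * (b - 1)
      = a * (b - 1) * (a - b) * (a - 1)"
    by (simp add: algebra_simps power2_eq_square)
  then show "x \<noteq> a"
    using sixth a b ab by auto
  have "b * (a - 1) * b\<^sup>2 - a * (a - b + b\<^sup>2 - 1) * b + a * b * (b - 1) = - b * (a - b)\<^sup>2"
    by (simp add: algebra_simps power2_eq_square)
  then show "x \<noteq> b"
    using sixth b ab by auto
qed

lemma seventh: "(a - 1) * x * y = a * b * (x - 1)"
  using a x_neq by (simp add: y_def)

text \<open>The homogenised quadratic: it allows x = m / k to be inserted without knowing that
  \<open>k\<close> is nonzero.\<close>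

lemma sixth_scaled:
  assumes "k * x = m"
  shows "b * (a - 1) * m\<^sup>2 - a * (a - b + b\<^sup>2 - 1) * m * k + a * b * (b - 1) * k\<^sup>2 = 0"
proof -
  have "b * (a - 1) * m\<^sup>2 - a * (a - b + b\<^sup>2 - 1) * m * k + a * b * (b - 1) * k\<^sup>2
      = k\<^sup>2 * (b * (a - 1) * x\<^sup>2 - a * (a - b + b\<^sup>2 - 1) * x + a * b * (b - 1))"
    unfolding assms[symmetric] by (simp add: algebra_simps power2_eq_square)
  then show ?thesis
    by (simp add: sixth)
qed

text \<open>The point \<open>Q\<close> lies on the line joining parameters \<open>\<infinity>\<close> and \<open>b / (1 + b - a)\<close>.\<close>

lemma x_neq_Q: "(1 + b - a) * x \<noteq> b"
proof
  assume "(1 + b - a) * x = b"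
  from sixth_scaled[OF this] have "b\<^sup>2 * (a - 1) * (b - a) * (1 - a) = 0"
    by (simp add: algebra_simps power2_eq_square)
  then show False
    using a b ab by simp
qed

text \<open>Excluding 0, \<open>b\<close> and \<open>x\<close> keeps consecutive vertices
  noncollinear; excluding 1, \<open>a\<close> and the last equation keeps the dual conic
  nondegenerate.\<close>

lemma y_neq: "y \<noteq> 0" "y \<noteq> 1" "y \<noteq> a" "y \<noteq> b" "y \<noteq> x" "(a + b - 1) * y \<noteq> a * b"
proof -
  show "y \<noteq> 0"
    using seventh a b x_neq by auto
  show "y \<noteq> 1"
  proof
    assume "y = 1"
    then have "(a * b - a + 1) * x = a * b"
      using seventh by (simp add: algebra_simps)
    from sixth_scaled[OF this] have "a * b * (a - 1) ^ 3 * (b - 1) = 0"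
      by (simp add: algebra_simps power2_eq_square power3_eq_cube)
    then show False
      using a b by simp
  qed
  show "y \<noteq> a"
  proof
    assume "y = a"
    then have "a * ((1 + b - a) * x) = a * b"
      using seventh by (simp add: algebra_simps)
    then show False
      using a x_neq_Q by simp
  qed
  show "y \<noteq> b"
  proof
    assume "y = b"
    \<comment> \<open>With \<open>y = b\<close>, the equation \<open>seventh\<close> would force
      \<open>x = a\<close>.\<close>
    moreover have "b * (a - x) = (a - 1) * x * b - a * b * (x - 1)"
      by (simp add: algebra_simps)
    ultimately show False
      using seventh b x_neq by simp
  qed
  show "y \<noteq> x"
  proof
    assume "y = x"
    then have *: "(a - 1) * x\<^sup>2 = a * b * (x - 1)"
      using seventh by (simp add: power2_eq_square mult.assoc)
    \<comment> \<open>Eliminating the square of \<open>x\<close> leaves a linear equation, whose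
      solution is the value ruled out by \<open>x_neq_Q\<close>.\<close>
    have "b * (a * b * (x - 1)) - a * (a - b + b\<^sup>2 - 1) * x + a * b * (b - 1) = 0"
      using sixth unfolding *[symmetric] by (simp add: mult.assoc)
    then have "a * ((1 + b - a) * x) = a * b"
      by (simp add: algebra_simps power2_eq_square)
    then show False
      using a x_neq_Q by simp
  qed
  show "(a + b - 1) * y \<noteq> a * b"
  proof
    assume *: "(a + b - 1) * y = a * b"
    \<comment> \<open>Multiplying \<open>seventh\<close> by \<open>a + b - 1\<close> eliminates
      \<open>y\<close> and leaves a linear equation for \<open>x\<close>.\<close>
    have "(a - 1) * x * ((a + b - 1) * y) = ((a - 1) * x * y) * (a + b - 1)"
      by (simp only: ac_simps)
    also have "\<dots> = a * b * (x - 1) * (a + b - 1)"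
      by (simp only: seventh)
    finally have "(a * b) * ((a - 1) * x) = (a * b) * ((x - 1) * (a + b - 1))"
      unfolding * by (simp add: ac_simps)
    then have "(a - 1) * x = (x - 1) * (a + b - 1)"
      using a b by simp
    then have "b * x = a + b - 1"
      by (simp add: algebra_simps)
    from sixth_scaled[OF this] have "b * (a - 1)\<^sup>2 * (b - 1)\<^sup>2 = 0"
      by (simp add: algebra_simps power2_eq_square)
    then show False
      using a b by simp
  qed
qed

text \<open>The coefficients of the dual conic are determined up to scaling by the requirement that
  the lines joining the parameters \<open>\<infinity>, 0\<close>; \<open>0, 1\<close>; \<open>1, a\<close>; \<open>a, b\<close> and \<open>y, \<infinity>\<close> lie on it.\<close>

definition \<alpha> :: 'k where "\<alpha> = a * b * (y - a)"
definition \<gamma> :: 'k where "\<gamma> = y * (a * b + a\<^sup>2 - 1) - a * (a * b + a - 1)"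

definition dual_conic :: "'k ^ 3 ^ 3" where
  "dual_conic = sym_matrix (2 * \<alpha>) \<alpha> \<gamma> 0 ((a - 1) * y) (2 * (a - 1))"

text \<open>The determinant factors completely, and its zeros in \<open>y\<close> are the values
  \<open>a\<close>, 1 and the root of (a + b - 1) y = a b, all excluded by
  \<open>y_neq\<close>.\<close>

lemma det_dual_conic: "det dual_conic \<noteq> 0"
proof -
  have "det dual_conic = - 2 * \<alpha> * (a - 1) * ((a - 1) * y\<^sup>2 + \<alpha> - \<gamma> * y)"
    by (simp add: dual_conic_def sym_matrix_def det_3 algebra_simps power2_eq_square)
  also have "(a - 1) * y\<^sup>2 + \<alpha> - \<gamma> * y = a * (y - 1) * (a * b - (a + b - 1) * y)"
    by (simp add: \<alpha>_def \<gamma>_def algebra_simps power2_eq_square)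
  finally show ?thesis
    using a b y_neq by (simp add: \<alpha>_def)
qed

abbreviation touches :: "'k ^ 3 \<Rightarrow> 'k ^ 3 \<Rightarrow> bool" where
  "touches u v \<equiv> bilin dual_conic (cross u v) (cross u v) = 0"

lemma touches_pt:
  assumes "\<alpha> * (1 - s - t) + s * t * (\<gamma> - (a - 1) * y * (s + t) + (a - 1) * s * t) = 0"
  shows "touches (pt s) (pt t)"
proof -
  have "bilin dual_conic (cross (pt s) (pt t)) (cross (pt s) (pt t)) = 2 * (s - t)\<^sup>2 *
      (\<alpha> * (1 - s - t) + s * t * (\<gamma> - (a - 1) * y * (s + t) + (a - 1) * s * t))"
    unfolding dual_conic_def bilin_sym_matrix_cross_pt
    by (simp add: algebra_simps power2_eq_square)
  then show ?thesis
    using assms by simp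
qed

lemma touches_all:
  "touches (pt y) pt_inf" "touches pt_inf (pt 0)" "touches (pt 0) (pt 1)" "touches (pt 1) (pt a)"
  "touches (pt a) (pt b)" "touches (pt b) (pt x)" "touches (pt x) (pt y)"
proof -
  \<comment> \<open>The zero in the middle of \<open>dual_conic\<close> handles the side through
    parameters \<infinity> and 0; the ratio of its last two coefficients handles the side through
    \<open>y\<close> and \<infinity>.\<close>
  show "touches (pt y) pt_inf" "touches pt_inf (pt 0)"
    unfolding dual_conic_def bilin_sym_matrix_cross_pt
    by (simp_all add: algebra_simps power2_eq_square)
  show "touches (pt 0) (pt 1)"
    by (rule touches_pt) simp
  show "touches (pt 1) (pt a)" "touches (pt a) (pt b)"
    by (rule touches_pt, simp add: \<alpha>_def \<gamma>_def algebra_simps power2_eq_square)+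
  let ?R = "(a - 1) * x * y - a * b * (x - 1)"
  have R: "?R = 0"
    using seventh by simp
  \<comment> \<open>The only side where the quadratic is used: the condition is a combination of
    that quadratic and of the relation \<open>?R\<close> between \<open>x\<close> and
    \<open>y\<close>.\<close>
  have "\<alpha> * (1 - b - x) + b * x * (\<gamma> - (a - 1) * y * (b + x) + (a - 1) * b * x)
      = (b - 1) * (a - b) * ?R
        + (b - y) * (b * (a - 1) * x\<^sup>2 - a * (a - b + b\<^sup>2 - 1) * x + a * b * (b - 1))"
    by (simp add: \<alpha>_def \<gamma>_def algebra_simps power2_eq_square)
  then show "touches (pt b) (pt x)"
    by (intro touches_pt) (simp only: R sixth mult_zero_right add_0)
  \<comment> \<open>One tangent through \<open>pt y\<close> passes through \<open>pt_inf\<close>, so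
    the condition on the other is only linear in \<open>x\<close>; it is a multiple of
    \<open>?R\<close>.\<close>
  have "(a - 1) * (\<alpha> * (1 - x - y) + x * y * (\<gamma> - (a - 1) * y * (x + y) + (a - 1) * x * y))
      = ?R * (\<gamma> - (a - 1) * y\<^sup>2 + a * b * (a - y))"
    by (simp add: \<alpha>_def \<gamma>_def algebra_simps power2_eq_square)
  then show "touches (pt x) (pt y)"
    using a by (intro touches_pt) (simp only: R mult_zero_left mult_eq_0_iff right_minus_eq simp_thms)
qed

end

section \<open>The periodic vertex sequence and its projective images\<close>

context heptagon_params
begin

text \<open>Index 0 holds the seventh vertex \<open>pt y\<close>, so that reduction modulo 7 gives
  the first six vertices the indices 1 to 6.\<close>

definition W :: "nat \<Rightarrow> 'k ^ 3" where
  "W n = [pt y, pt_inf, pt 0, pt 1, pt a, pt b, pt x] ! (n mod 7)"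

lemma W_simps:
  "W 0 = pt y" "W 1 = pt_inf" "W 2 = pt 0" "W 3 = pt 1" "W 4 = pt a" "W 5 = pt b" "W 6 = pt x"
  "W 7 = pt y" "W 8 = pt_inf" "W (Suc 0) = pt_inf" "W (Suc (Suc 0)) = pt 0" "W (Suc (Suc (Suc 0))) = pt 1"
  by (simp_all add: W_def)

lemma W_periodic: "W (n + 7) = W n"
  by (simp add: W_def)

text \<open>Reduces a 7-periodic claim to seven concrete cases.\<close>

lemma W_induct:
  assumes "P 0" "P 1" "P 2" "P 3" "P 4" "P 5" "P 6" "\<And>n. P n \<Longrightarrow> P (n + 7)"
  shows "P (n :: nat)"
proof (induct n rule: less_induct)
  case (less n)
  show ?case
  proof (cases "n < 7")
    case True
    then have "n = 0 \<or> n = 1 \<or> n = 2 \<or> n = 3 \<or> n = 4 \<or> n = 5 \<or> n = 6"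
      by arith
    then show ?thesis
      using assms(1-7) by auto
  next
    case False
    then show ?thesis
      using assms(8)[of "n - 7"] less[of "n - 7"] by simp
  qed
qed

lemma W_shift: "W (n + 7 + 1) = W (n + 1)" "W (n + 7 + 2) = W (n + 2)"
  using W_periodic[of "n + 1"] W_periodic[of "n + 2"] by (simp_all add: add.commute add.left_commute)

lemma W_on_conic: "bilin std_conic (W n) (W n) = 0"
proof (induct n rule: W_induct)
  case (8 n)
  then show ?case
    by (simp only: W_periodic)
qed (simp_all add: W_simps bilin_std_conic power2_eq_square)

lemma W_noncollinear: "det (vector [W n, W (n + 1), W (n + 2)] :: 'k ^ 3 ^ 3) \<noteq> 0"
proof (induct n rule: W_induct)
  case (8 n)
  then show ?case
    by (simp only: W_shift W_periodic not_False_eq_True)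
qed (use a b ab x_neq y_neq in \<open>simp_all add: W_simps det_pt\<close>)

lemma W_touches: "touches (W n) (W (n + 1))"
proof (induct n rule: W_induct)
  case (8 n)
  then show ?case
    by (simp only: W_shift W_periodic)
qed (use touches_all in \<open>simp_all add: W_simps\<close>)

text \<open>\<open>M\<close> carries the standard heptagon onto \<open>A\<close>. Since lines
  transform contragrediently, the transported dual conic is
  \<open>M ** dual_conic ** transpose M\<close>.\<close>

lemma poncelet_heptagon_W:
  fixes M A :: "'k ^ 3 ^ 3"
  assumes A: "transpose A = A" and M: "det M \<noteq> 0" and c: "c \<noteq> 0"
    and AM: "\<And>u v. bilin A (M *v u) (M *v v) = c * bilin std_conic u v"
  shows "\<exists>B. poncelet_heptagon A B (\<lambda>n. abs_proj_plane (M *v W n))"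
proof (rule poncelet_heptagonI[where D = "M ** dual_conic ** transpose M"])
  have "det A \<noteq> 0"
  proof
    \<comment> \<open>A kernel vector of \<open>A\<close>, pulled back along \<open>M\<close>, would
      lie in the radical of \<open>std_conic\<close>, which is zero.\<close>
    assume "det A = 0"
    then have "\<not> invertible A"
      by (simp add: invertible_det_nz)
    then obtain v where v: "v \<noteq> 0" "A *v v = 0"
      by (metis invertible_left_inverse matrix_left_invertible_ker)
    obtain u where u: "u \<noteq> 0" "M *v u = v"
      using M v(1) by (rule matrix_vector_mult_surj)
    have "bilin A w v = 0" for w
    proof -
      have "bilin A w v = (\<Sum>i\<in>UNIV. w $ i * (A *v v) $ i)"
        by (simp add: bilin_def matrix_vector_mult_def sum_3 algebra_simps)
      then show ?thesis
        by (simp add: v(2))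
    qed
    then have "bilin std_conic w u = 0" for w
      using AM[of w u] u(2) c by simp
    from this[of "axis 1 1"] this[of "axis 2 1"] this[of "axis 3 1"] show False
      using u(1) by (simp add: bilin_std_conic axis_def vec_eq_iff forall_3)
  qed
  moreover from this have "A \<noteq> 0"
    by (auto simp: det_3)
  ultimately show "nondegenerate_conic A"
    using A by (simp add: nondegenerate_conic_def is_conic_def)
  show "transpose (M ** dual_conic ** transpose M) = M ** dual_conic ** transpose M"
    by (simp add: matrix_transpose_mul dual_conic_def transpose_sym_matrix matrix_mul_assoc)
  show "det (M ** dual_conic ** transpose M) \<noteq> 0"
    using M det_dual_conic by (simp add: det_mul)
  show "M *v W (n + 7) = M *v W n" for n
    by (simp only: W_periodic)
  show "bilin A (M *v W n) (M *v W n) = 0" for n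
    by (simp add: AM W_on_conic)
  show "det (vector [M *v W n, M *v W (n + 1), M *v W (n + 2)] :: 'k ^ 3 ^ 3) \<noteq> 0" for n
    using M W_noncollinear[of n] by (simp add: det_vector_matrix_mult)
  show "bilin (M ** dual_conic ** transpose M) (cross (M *v W n) (M *v W (n + 1)))
      (cross (M *v W n) (M *v W (n + 1))) = 0" for n
  proof -
    have "bilin (M ** dual_conic ** transpose M) (cross (M *v W n) (M *v W (n + 1)))
        (cross (M *v W n) (M *v W (n + 1)))
      = bilin dual_conic (transpose M *v cross (M *v W n) (M *v W (n + 1)))
        (transpose M *v cross (M *v W n) (M *v W (n + 1)))"
      by (simp only: bilin_mult transpose_transpose)
    also have "\<dots> = det M * det M * bilin dual_conic (cross (W n) (W (n + 1))) (cross (W n) (W (n + 1)))"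
      unfolding transpose_mult_cross by (simp add: bilin_def sum_distrib_left ac_simps)
    finally show ?thesis
      by (simp only: W_touches mult_zero_right)
  qed
qed

end

section \<open>Normalising five points of a conic\<close>

text \<open>The equations are those of a conic through the three coordinate points. If
  \<open>p = 0\<close>, division by the third coordinate leaves a linear system for \<open>q\<close>
  and \<open>r\<close> with nonzero determinant.\<close>

lemma mixed_products_vanish:
  fixes p q r :: "'k::field"
  assumes "p * x1 * x2 + q * x1 * x3 + r * x2 * x3 = 0" "p * y1 * y2 + q * y1 * y3 + r * y2 * y3 = 0"
    and "x3 \<noteq> 0" "y3 \<noteq> 0" "x1 * y2 - x2 * y1 \<noteq> 0" and "p = 0"
  shows "q = 0 \<and> r = 0"
proof -
  have x: "q * x1 + r * x2 = 0" and y: "q * y1 + r * y2 = 0"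
    using assms(1-4,6) by (metis add_0 distrib_right mult.assoc mult_zero_left no_zero_divisors)+
  have "q * (x1 * y2 - x2 * y1) = (q * x1 + r * x2) * y2 - (q * y1 + r * y2) * x2"
    and "r * (x1 * y2 - x2 * y1) = (q * y1 + r * y2) * x1 - (q * x1 + r * x2) * y1"
    by (simp_all add: algebra_simps)
  then show ?thesis
    using assms(5) by (simp add: x y)
qed

text \<open>In the basis \<open>v1\<close>, \<open>v2\<close>, \<open>v3\<close> only mixed products
  survive. The points \<open>v4\<close> and \<open>v5\<close> force all three coefficients to be
  nonzero, and rescaling then yields the standard conic.\<close>

lemma conic_normal_form:
  fixes A :: "'k::field_char_0 ^ 3 ^ 3"
  assumes A: "is_conic A"
    and on_A: "bilin A v1 v1 = 0" "bilin A v2 v2 = 0" "bilin A v3 v3 = 0"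
      "bilin A v4 v4 = 0" "bilin A v5 v5 = 0"
    and noncol: "det (vector [v1, v2, v3] :: 'k ^ 3 ^ 3) \<noteq> 0"
      "det (vector [v1, v2, v4] :: 'k ^ 3 ^ 3) \<noteq> 0" "det (vector [v1, v2, v5] :: 'k ^ 3 ^ 3) \<noteq> 0"
      "det (vector [v1, v3, v4] :: 'k ^ 3 ^ 3) \<noteq> 0" "det (vector [v1, v3, v5] :: 'k ^ 3 ^ 3) \<noteq> 0"
      "det (vector [v2, v3, v4] :: 'k ^ 3 ^ 3) \<noteq> 0" "det (vector [v2, v3, v5] :: 'k ^ 3 ^ 3) \<noteq> 0"
      "det (vector [v1, v4, v5] :: 'k ^ 3 ^ 3) \<noteq> 0" "det (vector [v2, v4, v5] :: 'k ^ 3 ^ 3) \<noteq> 0"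
      "det (vector [v3, v4, v5] :: 'k ^ 3 ^ 3) \<noteq> 0"
  obtains M c k1 k2 k3 where "det M \<noteq> 0" "c \<noteq> 0"
    "\<And>u v. bilin A (M *v u) (M *v v) = c * bilin std_conic u v"
    "k1 \<noteq> 0" "M *v pt_inf = k1 *s v1" "k2 \<noteq> 0" "M *v pt 0 = k2 *s v2" "k3 \<noteq> 0" "M *v pt 1 = k3 *s v3"
proof -
  define N where "N = transpose (vector [v1, v2, v3] :: 'k ^ 3 ^ 3)"
  have N0: "det N \<noteq> 0"
    using noncol(1) by (simp add: N_def)
  have Nu: "N *v u = u$1 *s v1 + u$2 *s v2 + u$3 *s v3" for u
    by (simp add: N_def matrix_vector_mult_def transpose_def sum_3 vec_eq_iff mult.commute)
  let ?e1 = "vector [1, 0, 0] :: 'k ^ 3" and ?e2 = "vector [0, 1, 0] :: 'k ^ 3"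
    and ?e3 = "vector [0, 0, 1] :: 'k ^ 3"
  have Ne: "N *v ?e1 = v1" "N *v ?e2 = v2" "N *v ?e3 = v3"
    by (simp_all add: Nu)
  have "v4 \<noteq> 0" "v5 \<noteq> 0"
    using noncol(2,3) by (auto simp: det_3)
  then obtain x y where x: "N *v x = v4" and y: "N *v y = v5"
    using N0 matrix_vector_mult_surj by metis
  define h where "h u v = bilin A (N *v u) (N *v v)" for u v
  define h12 h13 h23 where h_defs: "h12 = h ?e1 ?e2" "h13 = h ?e1 ?e3" "h23 = h ?e2 ?e3"
  define H where "H = transpose N ** A ** N"
  have hH: "h u v = bilin H u v" for u v
    by (simp add: h_def H_def bilin_mult)
  have "transpose A = A" "A \<noteq> 0"
    using A by (simp_all add: is_conic_def)
  then have h_sym: "h u v = h v u" for u v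
    by (simp add: h_def bilin_commute)
  have H_entries: "H $ 1 $ 1 = 0" "H $ 2 $ 2 = 0" "H $ 3 $ 3 = 0"
      "H $ 1 $ 2 = h12" "H $ 2 $ 1 = h12" "H $ 1 $ 3 = h13" "H $ 3 $ 1 = h13"
      "H $ 2 $ 3 = h23" "H $ 3 $ 2 = h23"
  proof -
    have "h ?e1 ?e1 = 0" "h ?e2 ?e2 = 0" "h ?e3 ?e3 = 0"
      using on_A by (simp_all add: h_def Ne)
    then show "H $ 1 $ 1 = 0" "H $ 2 $ 2 = 0" "H $ 3 $ 3 = 0"
      by (simp_all add: hH bilin_def sum_3)
    show "H $ 1 $ 2 = h12" "H $ 1 $ 3 = h13" "H $ 2 $ 3 = h23"
      by (simp_all add: h_defs hH bilin_def sum_3)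
    show "H $ 2 $ 1 = h12" "H $ 3 $ 1 = h13" "H $ 3 $ 2 = h23"
      unfolding h_defs by (subst h_sym, simp add: hH bilin_def sum_3)+
  qed
  have h_eq: "h u v = h12 * (u$1 * v$2 + u$2 * v$1) + h13 * (u$1 * v$3 + u$3 * v$1)
      + h23 * (u$2 * v$3 + u$3 * v$2)" for u v
    by (simp add: hH bilin_def sum_3 H_entries algebra_simps)
  have on_H: "h12 * u$1 * u$2 + h13 * u$1 * u$3 + h23 * u$2 * u$3 = 0"
    if "bilin A (N *v u) (N *v u) = 0" for u
  proof -
    have "2 * (h12 * u$1 * u$2 + h13 * u$1 * u$3 + h23 * u$2 * u$3) = h u u"
      unfolding h_eq by (simp add: algebra_simps)
    then show ?thesis
      using that unfolding h_def by (metis mult_eq_0_iff zero_neq_numeral)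
  qed
  have hx: "h12 * x$1 * x$2 + h13 * x$1 * x$3 + h23 * x$2 * x$3 = 0"
    and hy: "h12 * y$1 * y$2 + h13 * y$1 * y$3 + h23 * y$2 * y$3 = 0"
    using on_A(4,5) by (simp_all add: on_H x y)
  have det_N: "det (vector [u, v, w] :: 'k ^ 3 ^ 3) \<noteq> 0"
    if "det (vector [N *v u, N *v v, N *v w] :: 'k ^ 3 ^ 3) \<noteq> 0" for u v w
    using that by (simp add: det_vector_matrix_mult)
  \<comment> \<open>Up to sign, these determinants are the coordinates of \<open>x\<close> and
    \<open>y\<close>; the next three are their 2 by 2 minors.\<close>
  have "det (vector [?e1, ?e2, x] :: 'k ^ 3 ^ 3) \<noteq> 0" "det (vector [?e1, ?e2, y] :: 'k ^ 3 ^ 3) \<noteq> 0"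
    "det (vector [?e1, ?e3, x] :: 'k ^ 3 ^ 3) \<noteq> 0" "det (vector [?e1, ?e3, y] :: 'k ^ 3 ^ 3) \<noteq> 0"
    "det (vector [?e2, ?e3, x] :: 'k ^ 3 ^ 3) \<noteq> 0" "det (vector [?e2, ?e3, y] :: 'k ^ 3 ^ 3) \<noteq> 0"
    by (rule det_N, simp only: Ne x y noncol not_False_eq_True)+
  then have nz: "x$1 \<noteq> 0" "x$2 \<noteq> 0" "x$3 \<noteq> 0" "y$1 \<noteq> 0" "y$2 \<noteq> 0" "y$3 \<noteq> 0"
    by (simp_all add: det_3)
  have "det (vector [?e1, x, y] :: 'k ^ 3 ^ 3) \<noteq> 0" "det (vector [?e2, x, y] :: 'k ^ 3 ^ 3) \<noteq> 0"
    "det (vector [?e3, x, y] :: 'k ^ 3 ^ 3) \<noteq> 0"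
    by (rule det_N, simp only: Ne x y noncol not_False_eq_True)+
  then have minors: "x$1 * y$2 - x$2 * y$1 \<noteq> 0" "x$1 * y$3 - x$3 * y$1 \<noteq> 0" "x$2 * y$3 - x$3 * y$2 \<noteq> 0"
    by (auto simp: det_3 mult.commute)
  have not_all: "\<not> (h12 = 0 \<and> h13 = 0 \<and> h23 = 0)"
  proof
    assume "h12 = 0 \<and> h13 = 0 \<and> h23 = 0"
    then have "h u v = 0" for u v
      by (simp add: h_eq)
    then have "bilin A u v = 0" if "u \<noteq> 0" "v \<noteq> 0" for u v
      using N0 that matrix_vector_mult_surj unfolding h_def by metis
    then have "bilin A (axis i 1) (axis j 1) = 0" for i j
      by (simp add: axis_eq_0_iff)
    moreover have "bilin A (axis i 1) (axis j 1) = A $ i $ j" for i j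
      using exhaust_3[of i] exhaust_3[of j] by (auto simp: bilin_def axis_def sum_3)
    ultimately show False
      using \<open>A \<noteq> 0\<close> by (simp add: vec_eq_iff)
  qed
  have h0: "h12 \<noteq> 0" "h13 \<noteq> 0" "h23 \<noteq> 0"
  proof -
    show "h12 \<noteq> 0"
      using mixed_products_vanish[OF hx hy nz(3,6) minors(1)] not_all by blast
    \<comment> \<open>The same lemma with the coordinates permuted, so that another coefficient
      takes the place of \<open>p\<close>.\<close>
    have "h13 * x$1 * x$3 + h12 * x$1 * x$2 + h23 * x$3 * x$2 = 0"
      "h13 * y$1 * y$3 + h12 * y$1 * y$2 + h23 * y$3 * y$2 = 0"
      using hx hy by (simp_all add: algebra_simps)
    from mixed_products_vanish[OF this nz(2,5) minors(2)] show "h13 \<noteq> 0"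
      using not_all by blast
    have "h23 * x$2 * x$3 + h12 * x$2 * x$1 + h13 * x$3 * x$1 = 0"
      "h23 * y$2 * y$3 + h12 * y$2 * y$1 + h13 * y$3 * y$1 = 0"
      using hx hy by (simp_all add: algebra_simps)
    from mixed_products_vanish[OF this nz(1,4) minors(3)] show "h23 \<noteq> 0"
      using not_all by blast
  qed
  \<comment> \<open>\<open>S\<close> sends the parameters \<infinity>, 0, 1 to multiples of the
    three basis vectors; the factors \<open>h23\<close>, \<open>h13\<close>, \<open>h12\<close>
    balance the three mixed terms.\<close>
  define S :: "'k ^ 3 ^ 3" where
    "S = vector [vector [h23, - h23, 0], vector [0, - h13, h13], vector [0, h12, 0]]"
  have Su: "S *v u = vector [h23 * (u$1 - u$2), h13 * (u$3 - u$2), h12 * u$2]" for u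
    by (simp add: S_def matrix_vector_mult_def sum_3 vec_eq_iff forall_3 algebra_simps)
  show ?thesis
  proof (rule that[of "N ** S" "h12 * h13 * h23" h23 h13 h12])
    have "det S \<noteq> 0"
      using h0 by (simp add: S_def det_3)
    then show "det (N ** S) \<noteq> 0"
      using N0 by (simp only: det_mul mult_eq_0_iff simp_thms)
    show "h12 * h13 * h23 \<noteq> 0" "h23 \<noteq> 0" "h13 \<noteq> 0" "h12 \<noteq> 0"
      using h0 by simp_all
    fix u v
    have "bilin A (N ** S *v u) (N ** S *v v) = h (S *v u) (S *v v)"
      by (simp add: h_def matrix_vector_mul_assoc)
    also have "\<dots> = h12 * h13 * h23 * bilin std_conic u v"
      unfolding h_eq Su bilin_std_conic by (simp add: algebra_simps)
    finally show "bilin A (N ** S *v u) (N ** S *v v) = h12 * h13 * h23 * bilin std_conic u v" .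
  qed (simp_all add: matrix_vector_mul_assoc[symmetric] Su Nu)
qed

section \<open>From the construction to the quadratic equation\<close>

lemma std_conic_point:
  assumes "bilin std_conic w w = (0 :: 'k::field_char_0)" "w$3 \<noteq> 0"
  shows "w = w$3 *s pt (w$2 / w$3)"
proof -
  have "2 * (w$1 * w$3 - w$2 * w$2) = 0"
    using assms(1) by (simp add: bilin_std_conic algebra_simps)
  then show ?thesis
    using assms(2) by (simp add: vec_eq_iff forall_3 field_simps power2_eq_square)
qed

lemma std_conic_point_inf:
  assumes "bilin std_conic w w = (0 :: 'k::field_char_0)" "w$3 = 0"
  shows "w = w$1 *s pt_inf"
  using assms by (simp add: bilin_std_conic vec_eq_iff forall_3)

text \<open>Each constructed point is fixed up to scale by linear relations between its coordinates;
  inserting them into the determinant of \<open>r'\<close>, \<open>q'\<close>, \<open>w\<close>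
  gives the equation of the line l.\<close>

lemma sixth_point_line:
  fixes o' p' q' r' w :: "'k::field ^ 3"
  assumes nz: "o' \<noteq> 0" "p' \<noteq> 0" "q' \<noteq> 0" "r' \<noteq> 0"
    and ab: "a \<noteq> 0" "a \<noteq> 1" "b \<noteq> 0" "b \<noteq> 1" "a \<noteq> b"
    and O: "det (vector [pt_inf, pt a, o'] :: 'k ^ 3 ^ 3) = 0" "det (vector [pt 0, pt b, o'] :: 'k ^ 3 ^ 3) = 0"
    and P: "det (vector [pt_inf, pt 1, p'] :: 'k ^ 3 ^ 3) = 0" "det (vector [pt 0, pt a, p'] :: 'k ^ 3 ^ 3) = 0"
    and Q: "det (vector [pt 0, pt a, q'] :: 'k ^ 3 ^ 3) = 0" "det (vector [pt 1, pt b, q'] :: 'k ^ 3 ^ 3) = 0"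
    and R: "det (vector [pt_inf, pt b, r'] :: 'k ^ 3 ^ 3) = 0" "det (vector [o', p', r'] :: 'k ^ 3 ^ 3) = 0"
    and w: "det (vector [r', q', w] :: 'k ^ 3 ^ 3) = 0"
  shows "b * (a - 1) * w$1 - a * (a - b + b\<^sup>2 - 1) * w$2 + a * b * (b - 1) * w$3 = 0"
proof -
  have line0: "u$1 = t * u$2" if "det (vector [pt 0, pt t, u] :: 'k ^ 3 ^ 3) = 0" "t \<noteq> 0" for t and u :: "'k ^ 3"
  proof -
    have "det (vector [pt 0, pt t, u] :: 'k ^ 3 ^ 3) = - t * (u$1 - t * u$2)"
      by (simp add: det_3 algebra_simps power2_eq_square)
    then show ?thesis
      using that by simp
  qed
  have lineinf: "u$2 = t * u$3" if "det (vector [pt_inf, pt t, u] :: 'k ^ 3 ^ 3) = 0" for t and u :: "'k ^ 3"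
    using that by (simp add: det_3 algebra_simps)
  have o: "o'$2 = a * o'$3" "o'$1 = b * o'$2"
    using lineinf[OF O(1)] line0[OF O(2)] ab by simp_all
  have p: "p'$2 = p'$3" "p'$1 = a * p'$2"
    using lineinf[OF P(1)] line0[OF P(2)] ab by simp_all
  have r2: "r'$2 = b * r'$3"
    using lineinf[OF R(1)] .
  have q1: "q'$1 = a * q'$2"
    using line0[OF Q(1)] ab by simp
  have "det (vector [pt 1, pt b, q'] :: 'k ^ 3 ^ 3) = (1 - b) * (q'$1 - (1 + b) * q'$2 + b * q'$3)"
    by (simp add: det_3 algebra_simps power2_eq_square)
  then have "q'$1 - (1 + b) * q'$2 + b * q'$3 = 0"
    using Q(2) ab by simp
  then have q3: "b * q'$3 = (1 + b - a) * q'$2"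
    by (simp add: q1 algebra_simps)
  \<comment> \<open>If this coordinate vanished, the relations would make the whole vector
    zero.\<close>
  have "o'$3 \<noteq> 0" "p'$3 \<noteq> 0"
    using nz o p by (auto simp: vec_eq_iff forall_3)
  moreover have "o'$3 * p'$3 * ((a - 1) * r'$1 - a * (a + b\<^sup>2 - 2 * b) * r'$3) = 0"
    using R(2) by (simp add: det_3 o p r2 algebra_simps power2_eq_square)
  ultimately have r1: "(a - 1) * r'$1 = a * (a + b\<^sup>2 - 2 * b) * r'$3"
    by simp
  have "r'$3 \<noteq> 0" "q'$2 \<noteq> 0"
    using nz r1 r2 q1 q3 ab by (auto simp: vec_eq_iff forall_3)
  have "(b - a) * (r'$3 * q'$2 * (b * (a - 1) * w$1 - a * (a - b + b\<^sup>2 - 1) * w$2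
      + a * b * (b - 1) * w$3)) = (a - 1) * b * det (vector [r', q', w] :: 'k ^ 3 ^ 3)"
  proof -
    \<comment> \<open>The factor \<open>(a - 1) * b\<close> is distributed so that the relations for
      \<open>r'\<close> and \<open>q'\<close> apply without division.\<close>
    have "(a - 1) * b * det (vector [r', q', w] :: 'k ^ 3 ^ 3)
      = ((a - 1) * r'$1) * (b * q'$2) * w$3 - ((a - 1) * r'$1) * (b * q'$3) * w$2
       + (a - 1) * r'$2 * (b * q'$3) * w$1 - (a - 1) * b * r'$2 * q'$1 * w$3
       + (a - 1) * b * r'$3 * q'$1 * w$2 - (a - 1) * b * r'$3 * q'$2 * w$1"
      by (simp add: det_3 algebra_simps)
    also have "\<dots> = (b - a) * (r'$3 * q'$2 * (b * (a - 1) * w$1 - a * (a - b + b\<^sup>2 - 1) * w$2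
      + a * b * (b - 1) * w$3))"
      unfolding r1 q3 r2 q1 by (simp add: algebra_simps power2_eq_square)
    finally show ?thesis ..
  qed
  then show ?thesis
    using w ab \<open>r'$3 \<noteq> 0\<close> \<open>q'$2 \<noteq> 0\<close> by simp
qed

theorem theorem3:
  fixes p :: "nat \<Rightarrow> 'k::real_normed_field proj_plane"
    and A :: "'k ^ 3 ^ 3"
    and pO pP pQ pR :: "'k proj_plane"
    and l :: "'k proj_plane set"
  assumes no_three_collinear:
      "\<forall>i\<in>{1..5}. \<forall>j\<in>{1..5}. \<forall>k\<in>{1..5}. i < j \<and> j < k \<longrightarrow> \<not> proj_collinear (p i) (p j) (p k)"
    and conic_A: "is_conic A" "\<forall>i\<in>{1..5}. p i \<in> conic_points A"
    and O: "proj_line (p 1) (p 4) \<noteq> proj_line (p 2) (p 5)"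
      "pO \<in> proj_line (p 1) (p 4) \<inter> proj_line (p 2) (p 5)"
    and P: "proj_line (p 1) (p 3) \<noteq> proj_line (p 2) (p 4)"
      "pP \<in> proj_line (p 1) (p 3) \<inter> proj_line (p 2) (p 4)"
    and Q: "proj_line (p 2) (p 4) \<noteq> proj_line (p 3) (p 5)"
      "pQ \<in> proj_line (p 2) (p 4) \<inter> proj_line (p 3) (p 5)"
    and OP: "pO \<noteq> pP"
    and R: "proj_line (p 1) (p 5) \<noteq> proj_line pO pP"
      "pR \<in> proj_line (p 1) (p 5) \<inter> proj_line pO pP"
    and l: "pR \<noteq> pQ" "l = proj_line pR pQ"
    and p6: "p 6 \<in> l \<inter> conic_points A"
  shows "\<exists>B q. poncelet_heptagon A B q \<and> (\<forall>i\<in>{1..6}. q i = p i)"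
proof -
  have "\<exists>v. v \<noteq> 0 \<and> p n = abs_proj_plane v" for n
    by (rule proj_plane_cases[of "p n"]) blast
  then obtain V where V0: "\<And>n. V n \<noteq> 0" and pV: "\<And>n. p n = abs_proj_plane (V n)"
    by metis
  have noncol: "\<not> proj_collinear (p i) (p j) (p k)"
    if "1 \<le> i" "i < j" "j < k" "k \<le> 5" for i j k
    using no_three_collinear that by auto
  have on_A: "bilin A (V i) (V i) = 0" if "1 \<le> i" "i \<le> 5" for i
    using conic_A(2) that by (simp add: pV conic_points_def conjugate_abs V0)
  have noncol_V: "det (vector [V i, V j, V k] :: 'k ^ 3 ^ 3) \<noteq> 0"
    if "1 \<le> i" "i < j" "j < k" "k \<le> 5" for i j k
    using noncol[OF that] by (simp add: pV proj_collinear_abs V0)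
  obtain M c k1 k2 k3 where M: "det M \<noteq> 0" and c: "c \<noteq> 0"
    and AM: "\<And>u v. bilin A (M *v u) (M *v v) = c * bilin std_conic u v"
    and k: "k1 \<noteq> 0" "M *v pt_inf = k1 *s V 1" "k2 \<noteq> 0" "M *v pt 0 = k2 *s V 2"
      "k3 \<noteq> 0" "M *v pt 1 = k3 *s V 3"
    by (rule conic_normal_form[OF conic_A(1), of "V 1" "V 2" "V 3" "V 4" "V 5"])
      (simp_all add: on_A noncol_V)
  \<comment> \<open>\<open>\<rho>\<close> turns normalised coordinates into points of the given
    plane.\<close>
  define \<rho> where "\<rho> u = abs_proj_plane (M *v u)" for u
  have \<rho>_scale: "\<rho> (t *s u) = \<rho> u" if "u \<noteq> 0" "t \<noteq> 0" for t u
    using abs_proj_plane_scale[of "M *v u" t] matrix_vector_mult_nonzero[OF M] that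
    by (simp add: \<rho>_def vector_scalar_commute)
  have \<rho>_collinear: "proj_collinear (\<rho> u) (\<rho> v) (\<rho> w) \<longleftrightarrow> det (vector [u, v, w] :: 'k ^ 3 ^ 3) = 0"
    if "u \<noteq> 0" "v \<noteq> 0" "w \<noteq> 0" for u v w
    using M that by (simp add: \<rho>_def proj_collinear_abs matrix_vector_mult_nonzero det_vector_matrix_mult)
  have \<rho>_surj: "\<exists>u. u \<noteq> 0 \<and> q = \<rho> u" for q
    unfolding \<rho>_def using M by (metis proj_plane_cases matrix_vector_mult_surj)
  have \<rho>_conic: "bilin std_conic w w = 0" if "\<rho> w \<in> conic_points A" "w \<noteq> 0" for w
    using that M c by (simp add: \<rho>_def conic_points_def conjugate_abs matrix_vector_mult_nonzero AM)
  have p123: "p 1 = \<rho> pt_inf" "p (Suc 0) = \<rho> pt_inf" "p 2 = \<rho> (pt 0)" "p 3 = \<rho> (pt 1)"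
    by (simp_all add: \<rho>_def pV k V0 abs_proj_plane_scale)
  have param: "\<exists>t. p i = \<rho> (pt t)" if "i = 4 \<or> i = 5" for i
  proof -
    obtain w where w: "w \<noteq> 0" "p i = \<rho> w"
      using \<rho>_surj by blast
    have "p i \<in> conic_points A"
      using conic_A(2) that by force
    then have conic_w: "bilin std_conic w w = 0"
      using w by (intro \<rho>_conic) auto
    \<comment> \<open>Noncollinearity with \<open>p 1\<close> and \<open>p 2\<close> separates the
      point from \<open>p 1\<close>, hence its parameter is finite.\<close>
    have "det (vector [pt_inf, pt 0, w] :: 'k ^ 3 ^ 3) \<noteq> 0"
      using noncol[of 1 2 i] that w by (auto simp: p123 \<rho>_collinear)
    then have "w \<noteq> w$1 *s pt_inf"
      by (auto simp: det_3 vec_eq_iff forall_3)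
    then have "w$3 \<noteq> 0"
      using std_conic_point_inf[OF conic_w] by blast
    then have "\<rho> w = \<rho> (pt (w$2 / w$3))"
      using std_conic_point[OF conic_w] \<rho>_scale pt_nonzero(1) by metis
    then show ?thesis
      using w(2) by auto
  qed
  obtain a b where p45: "p 4 = \<rho> (pt a)" "p 5 = \<rho> (pt b)"
    using param by blast
  have a: "a \<noteq> 0" "a \<noteq> 1" and b: "b \<noteq> 0" "b \<noteq> 1" and ab: "a \<noteq> b"
    using noncol[of 1 2 4] noncol[of 1 3 4] noncol[of 1 2 5] noncol[of 1 3 5] noncol[of 1 4 5]
    by (auto simp: p123 p45 \<rho>_collinear det_pt)
  obtain o' p' q' r' w where nz: "o' \<noteq> 0" "p' \<noteq> 0" "q' \<noteq> 0" "r' \<noteq> 0" "w \<noteq> 0"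
    and \<rho>s: "pO = \<rho> o'" "pP = \<rho> p'" "pQ = \<rho> q'" "pR = \<rho> r'" "p 6 = \<rho> w"
    using \<rho>_surj by metis
  have line_w: "b * (a - 1) * w$1 - a * (a - b + b\<^sup>2 - 1) * w$2 + a * b * (b - 1) * w$3 = 0"
    by (rule sixth_point_line[of o' p' q' r'])
      (use nz a b ab O(2) P(2) Q(2) R(2) l(2) p6 in
        \<open>simp_all add: proj_line_def p123 p45 \<rho>s \<rho>_collinear\<close>)
  have conic_w: "bilin std_conic w w = 0"
    using p6 \<rho>s(5) nz(5) by (intro \<rho>_conic) auto
  \<comment> \<open>The line l misses \<open>p 1\<close>: at \<open>pt_inf\<close> its equation
    reduces to \<open>b * (a - 1)\<close>, which is nonzero. Hence \<open>p 6\<close> also has a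
    finite parameter.\<close>
  have w3: "w$3 \<noteq> 0"
  proof
    assume "w$3 = 0"
    from std_conic_point_inf[OF conic_w this] have "w$2 = 0" "w$3 = 0"
      by (simp_all add: vec_eq_iff forall_3)
    then show False
      using line_w a b nz(5) by (simp add: vec_eq_iff forall_3)
  qed
  define x where "x = w$2 / w$3"
  have w_eq: "w = w$3 *s pt x"
    unfolding x_def using conic_w w3 by (rule std_conic_point)
  then have p6_eq: "p 6 = \<rho> (pt x)"
    using \<rho>s(5) \<rho>_scale w3 pt_nonzero(1) by metis
  have "w$1 = w$3 * x\<^sup>2" "w$2 = w$3 * x"
    using arg_cong[OF w_eq, of "\<lambda>v. v $ 1"] arg_cong[OF w_eq, of "\<lambda>v. v $ 2"] by simp_all
  \<comment> \<open>On the parametrised conic, the line equation becomes the quadratic for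
    \<open>x\<close>.\<close>
  then have "w$3 * (b * (a - 1) * x\<^sup>2 - a * (a - b + b\<^sup>2 - 1) * x + a * b * (b - 1)) = 0"
    using line_w by (simp add: algebra_simps)
  then have sixth: "b * (a - 1) * x\<^sup>2 - a * (a - b + b\<^sup>2 - 1) * x + a * b * (b - 1) = 0"
    using w3 by simp
  interpret heptagon_params a b x "a * b * (x - 1) / ((a - 1) * x)"
    by unfold_locales (use a b ab sixth in simp_all)
  obtain B where "poncelet_heptagon A B (\<lambda>n. \<rho> (W n))"
    unfolding \<rho>_def using poncelet_heptagon_W[OF _ M c AM] conic_A(1) by (auto simp: is_conic_def)
  moreover have "\<rho> (W i) = p i" if "i \<in> {1..6}" for i
  proof -
    have "i = 1 \<or> i = 2 \<or> i = 3 \<or> i = 4 \<or> i = 5 \<or> i = 6"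
      using that by auto
    then show ?thesis
      using p123 p45 p6_eq by (auto simp: W_simps)
  qed
  ultimately show ?thesis
    by blast
qed

end
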